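(* For every positive integer $n$, the graph $\Phi(\mathbb H(\mathbb Z_{2^n}))$ is Hamiltonian.
   Context: $\mathbb H(\mathbb Z_{2^n})$ is the ring of Hamilton quaternions over $\mathbb Z_{2^n}$. Its elements are $a_1+a_2i+a_3j+a_4k$ with $a_i\in\mathbb Z_{2^n}$, written $(a_1,a_2,a_3,a_4)$. Addition is coordinatewise, and multiplication is determined by distributivity, scalars commuting with $i,j,k$, and $i^2=j^2=k^2=-1$, $ij=-ji=k$, $jk=-kj=i$, $ki=-ik=j$. For a ring $R$ with unity, the non-zero divisor graph $\Phi(R)$ is the simple graph with vertex set $R\setminus\{0,1,-1\}$ in which two distinct vertices $x,y$ are adjacent if and only if $xy\neq0$ or $yx\neq0$. A graph is Hamiltonian if it has a cycle through all of its vertices. *)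

theory Defs
  imports "HOL-Number_Theory.Residues" "Graph_Theory.Graph_Theory"
begin

text \<open>
  A quadruple \<open>(a\<^sub>1, a\<^sub>2, a\<^sub>3, a\<^sub>4)\<close> stands for \<open>a\<^sub>1 + a\<^sub>2 i + a\<^sub>3 j + a\<^sub>4 k\<close>. The product is the
  bilinear extension of \<open>i\<^sup>2 = j\<^sup>2 = k\<^sup>2 = -1\<close>, \<open>ij = -ji = k\<close>, \<open>jk = -kj = i\<close>, \<open>ki = -ik = j\<close>.
\<close>

definition quaternion_ring :: "('a, 'b) ring_scheme \<Rightarrow> ('a \<times> 'a \<times> 'a \<times> 'a) ring" where
  "quaternion_ring R = \<lparr>
     carrier = carrier R \<times> carrier R \<times> carrier R \<times> carrier R,
     monoid.mult = (\<lambda>(a1, a2, a3, a4) (b1, b2, b3, b4).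
       (a1 \<otimes>\<^bsub>R\<^esub> b1 \<ominus>\<^bsub>R\<^esub> a2 \<otimes>\<^bsub>R\<^esub> b2 \<ominus>\<^bsub>R\<^esub> a3 \<otimes>\<^bsub>R\<^esub> b3 \<ominus>\<^bsub>R\<^esub> a4 \<otimes>\<^bsub>R\<^esub> b4,
        a1 \<otimes>\<^bsub>R\<^esub> b2 \<oplus>\<^bsub>R\<^esub> a2 \<otimes>\<^bsub>R\<^esub> b1 \<oplus>\<^bsub>R\<^esub> a3 \<otimes>\<^bsub>R\<^esub> b4 \<ominus>\<^bsub>R\<^esub> a4 \<otimes>\<^bsub>R\<^esub> b3,
        a1 \<otimes>\<^bsub>R\<^esub> b3 \<ominus>\<^bsub>R\<^esub> a2 \<otimes>\<^bsub>R\<^esub> b4 \<oplus>\<^bsub>R\<^esub> a3 \<otimes>\<^bsub>R\<^esub> b1 \<oplus>\<^bsub>R\<^esub> a4 \<otimes>\<^bsub>R\<^esub> b2,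
        a1 \<otimes>\<^bsub>R\<^esub> b4 \<oplus>\<^bsub>R\<^esub> a2 \<otimes>\<^bsub>R\<^esub> b3 \<ominus>\<^bsub>R\<^esub> a3 \<otimes>\<^bsub>R\<^esub> b2 \<oplus>\<^bsub>R\<^esub> a4 \<otimes>\<^bsub>R\<^esub> b1)),
     one = (\<one>\<^bsub>R\<^esub>, \<zero>\<^bsub>R\<^esub>, \<zero>\<^bsub>R\<^esub>, \<zero>\<^bsub>R\<^esub>),
     zero = (\<zero>\<^bsub>R\<^esub>, \<zero>\<^bsub>R\<^esub>, \<zero>\<^bsub>R\<^esub>, \<zero>\<^bsub>R\<^esub>),
     add = (\<lambda>(a1, a2, a3, a4) (b1, b2, b3, b4).
       (a1 \<oplus>\<^bsub>R\<^esub> b1, a2 \<oplus>\<^bsub>R\<^esub> b2, a3 \<oplus>\<^bsub>R\<^esub> b3, a4 \<oplus>\<^bsub>R\<^esub> b4))\<rparr>"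

lemma (in cring) quaternion_ring_is_ring: "ring (quaternion_ring R)"
proof (rule ringI)
  show "abelian_group (quaternion_ring R)"
  proof (rule abelian_groupI)
    fix x assume "x \<in> carrier (quaternion_ring R)"
    then obtain a b c d where x: "x = (a, b, c, d)"
      and "a \<in> carrier R" "b \<in> carrier R" "c \<in> carrier R" "d \<in> carrier R"
      by (auto simp: quaternion_ring_def)
    then show "\<exists>y\<in>carrier (quaternion_ring R). y \<oplus>\<^bsub>quaternion_ring R\<^esub> x = \<zero>\<^bsub>quaternion_ring R\<^esub>"
      by (intro bexI[of _ "(\<ominus> a, \<ominus> b, \<ominus> c, \<ominus> d)"]) (auto simp: quaternion_ring_def l_neg)
  qed (auto simp: quaternion_ring_def a_ac)
  show "monoid (quaternion_ring R)"
  proof (rule monoidI)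
    fix x y z
    assume "x \<in> carrier (quaternion_ring R)" "y \<in> carrier (quaternion_ring R)"
      "z \<in> carrier (quaternion_ring R)"
    then obtain a1 a2 a3 a4 b1 b2 b3 b4 c1 c2 c3 c4
      where xyz: "x = (a1, a2, a3, a4)" "y = (b1, b2, b3, b4)" "z = (c1, c2, c3, c4)"
        and mem: "a1 \<in> carrier R" "a2 \<in> carrier R" "a3 \<in> carrier R" "a4 \<in> carrier R"
          "b1 \<in> carrier R" "b2 \<in> carrier R" "b3 \<in> carrier R" "b4 \<in> carrier R"
          "c1 \<in> carrier R" "c2 \<in> carrier R" "c3 \<in> carrier R" "c4 \<in> carrier R"
      by (cases x; cases y; cases z) (auto simp: quaternion_ring_def)
    show "x \<otimes>\<^bsub>quaternion_ring R\<^esub> y \<otimes>\<^bsub>quaternion_ring R\<^esub> z =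
      x \<otimes>\<^bsub>quaternion_ring R\<^esub> (y \<otimes>\<^bsub>quaternion_ring R\<^esub> z)"
      by (simp add: xyz quaternion_ring_def mem a_minus_def l_distr r_distr l_minus r_minus
          minus_add m_assoc a_ac)
  qed (auto simp: quaternion_ring_def a_minus_def)
next
  fix x y z
  assume "x \<in> carrier (quaternion_ring R)" "y \<in> carrier (quaternion_ring R)"
    "z \<in> carrier (quaternion_ring R)"
  then obtain a1 a2 a3 a4 b1 b2 b3 b4 c1 c2 c3 c4
    where xyz: "x = (a1, a2, a3, a4)" "y = (b1, b2, b3, b4)" "z = (c1, c2, c3, c4)"
      and mem: "a1 \<in> carrier R" "a2 \<in> carrier R" "a3 \<in> carrier R" "a4 \<in> carrier R"
        "b1 \<in> carrier R" "b2 \<in> carrier R" "b3 \<in> carrier R" "b4 \<in> carrier R"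
        "c1 \<in> carrier R" "c2 \<in> carrier R" "c3 \<in> carrier R" "c4 \<in> carrier R"
    by (cases x; cases y; cases z) (auto simp: quaternion_ring_def)
  show "(x \<oplus>\<^bsub>quaternion_ring R\<^esub> y) \<otimes>\<^bsub>quaternion_ring R\<^esub> z =
      x \<otimes>\<^bsub>quaternion_ring R\<^esub> z \<oplus>\<^bsub>quaternion_ring R\<^esub> y \<otimes>\<^bsub>quaternion_ring R\<^esub> z"
    and "z \<otimes>\<^bsub>quaternion_ring R\<^esub> (x \<oplus>\<^bsub>quaternion_ring R\<^esub> y) =
      z \<otimes>\<^bsub>quaternion_ring R\<^esub> x \<oplus>\<^bsub>quaternion_ring R\<^esub> z \<otimes>\<^bsub>quaternion_ring R\<^esub> y"
    by (simp_all add: xyz quaternion_ring_def mem a_minus_def l_distr r_distr l_minus r_minus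
        minus_add a_ac)
qed

lemma (in cring) quaternion_ring_basis:
  defines "Q \<equiv> quaternion_ring R"
  defines "qi \<equiv> (\<zero>, \<one>, \<zero>, \<zero>)" and "qj \<equiv> (\<zero>, \<zero>, \<one>, \<zero>)" and "qk \<equiv> (\<zero>, \<zero>, \<zero>, \<one>)"
  shows "qi \<otimes>\<^bsub>Q\<^esub> qi = \<ominus>\<^bsub>Q\<^esub> \<one>\<^bsub>Q\<^esub>" "qj \<otimes>\<^bsub>Q\<^esub> qj = \<ominus>\<^bsub>Q\<^esub> \<one>\<^bsub>Q\<^esub>" "qk \<otimes>\<^bsub>Q\<^esub> qk = \<ominus>\<^bsub>Q\<^esub> \<one>\<^bsub>Q\<^esub>"
    "qi \<otimes>\<^bsub>Q\<^esub> qj = qk" "qj \<otimes>\<^bsub>Q\<^esub> qi = \<ominus>\<^bsub>Q\<^esub> qk"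
    "qj \<otimes>\<^bsub>Q\<^esub> qk = qi" "qk \<otimes>\<^bsub>Q\<^esub> qj = \<ominus>\<^bsub>Q\<^esub> qi"
    "qk \<otimes>\<^bsub>Q\<^esub> qi = qj" "qi \<otimes>\<^bsub>Q\<^esub> qk = \<ominus>\<^bsub>Q\<^esub> qj"
proof -
  interpret Q: ring Q
    unfolding Q_def by (rule quaternion_ring_is_ring)
  have neg: "\<ominus>\<^bsub>Q\<^esub> (a, b, c, d) = (\<ominus> a, \<ominus> b, \<ominus> c, \<ominus> d)"
    if "a \<in> carrier R" "b \<in> carrier R" "c \<in> carrier R" "d \<in> carrier R" for a b c d
    by (rule Q.minus_equality) (use that in \<open>auto simp: Q_def quaternion_ring_def l_neg\<close>)
  have one: "\<one>\<^bsub>Q\<^esub> = (\<one>, \<zero>, \<zero>, \<zero>)"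
    by (simp add: Q_def quaternion_ring_def)
  note simps = neg one qi_def qj_def qk_def
  show "qi \<otimes>\<^bsub>Q\<^esub> qi = \<ominus>\<^bsub>Q\<^esub> \<one>\<^bsub>Q\<^esub>" "qj \<otimes>\<^bsub>Q\<^esub> qj = \<ominus>\<^bsub>Q\<^esub> \<one>\<^bsub>Q\<^esub>" "qk \<otimes>\<^bsub>Q\<^esub> qk = \<ominus>\<^bsub>Q\<^esub> \<one>\<^bsub>Q\<^esub>"
    "qi \<otimes>\<^bsub>Q\<^esub> qj = qk" "qj \<otimes>\<^bsub>Q\<^esub> qi = \<ominus>\<^bsub>Q\<^esub> qk"
    "qj \<otimes>\<^bsub>Q\<^esub> qk = qi" "qk \<otimes>\<^bsub>Q\<^esub> qj = \<ominus>\<^bsub>Q\<^esub> qi"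
    "qk \<otimes>\<^bsub>Q\<^esub> qi = qj" "qi \<otimes>\<^bsub>Q\<^esub> qk = \<ominus>\<^bsub>Q\<^esub> qj"
    by (simp_all add: simps, simp_all add: Q_def quaternion_ring_def a_minus_def)
qed

text \<open>As usual in \<open>Graph_Theory\<close>, a simple graph is a symmetric loop-free digraph.\<close>

definition non_zero_divisor_graph :: "('a, 'b) ring_scheme \<Rightarrow> 'a pair_pre_digraph" where
  "non_zero_divisor_graph R =
     (let V = carrier R - {\<zero>\<^bsub>R\<^esub>, \<one>\<^bsub>R\<^esub>, \<ominus>\<^bsub>R\<^esub> \<one>\<^bsub>R\<^esub>} in
      \<lparr>pverts = V,
       parcs = {(x, y). x \<in> V \<and> y \<in> V \<and> x \<noteq> y \<and>
                        (x \<otimes>\<^bsub>R\<^esub> y \<noteq> \<zero>\<^bsub>R\<^esub> \<or> y \<otimes>\<^bsub>R\<^esub> x \<noteq> \<zero>\<^bsub>R\<^esub>)}\<rparr>)"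

lemma pair_graph_non_zero_divisor_graph:
  assumes "finite (carrier R)"
  shows "pair_graph (non_zero_divisor_graph R)"
proof -
  have "finite (parcs (non_zero_divisor_graph R))"
    by (rule finite_subset[of _ "carrier R \<times> carrier R"])
      (use assms in \<open>auto simp: non_zero_divisor_graph_def Let_def\<close>)
  then show ?thesis
    using assms
    by unfold_locales
      (auto simp: non_zero_divisor_graph_def Let_def symmetric_def arcs_ends_def arc_to_ends_def sym_def)
qed

text \<open>
  The bound on the length excludes the walk \<open>u, v, u\<close>, which is a cycle of a symmetric digraph
  but not of the simple graph that it represents.
\<close>

definition hamiltonian :: "('a, 'b) pre_digraph \<Rightarrow> bool" where
  "hamiltonian G \<longleftrightarrow>
     (\<exists>p. pre_digraph.cycle G p \<and> 3 \<le> length p \<and> tail G ` set p = verts G)"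

end

theory Submission
  imports Defs
begin

text \<open>
  A quaternion over \<open>\<int>/2\<^sup>n\<close> whose coordinates have odd sum has odd norm, hence is a unit and is
  adjacent to every other vertex. Changing the parity of the first coordinate shows that there are as
  many quaternions with odd coordinate sum as with even one. After removing \<open>0\<close>, \<open>1\<close> and \<open>-1\<close>, the
  even vertices are as many as the odd ones if \<open>n = 1\<close>, and exceed them by one if \<open>n > 1\<close>. So an
  alternating closed sequence exists, with, for \<open>n > 1\<close>, one edge between two even vertices,
  for which \<open>(1 + i)(1 + j) \<noteq> 0\<close> is used.
\<close>

section \<open>Hamiltonian cycles from vertex lists and from alternation\<close>

lemma awalk_of_vertex_list:
  fixes G :: "'a pair_pre_digraph"
  assumes "vs \<noteq> []" "successively (\<lambda>x y. (x, y) \<in> parcs G) (vs @ [w])"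
  defines "p \<equiv> zip vs (tl vs @ [w])"
  shows "set p \<subseteq> parcs G" "pre_digraph.cas (with_proj G) (hd vs) p w"
    "pre_digraph.awalk_verts (with_proj G) (hd vs) p = vs @ [w]"
  using assms(1,2) unfolding p_def
\<comment> \<open>The target \<open>w\<close> is independent of the list: with
  \<open>w = hd vs\<close> the induction would fail, since the head changes as the list
  shrinks.\<close>
proof (induction vs rule: list_nonempty_induct)
  case (single x)
  {
    case 1
    then show ?case by simp
  next
    case 2
    then show ?case by (simp add: pre_digraph.cas.simps)
  next
    case 3
    then show ?case by (simp add: pre_digraph.awalk_verts.simps)
  }
next
  case (cons x xs)
  then obtain y ys where xs: "xs = y # ys"
    by (cases xs) auto
  {
    case 1
    then show ?case using cons by (simp add: xs)
  next
    case 2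
    then show ?case using cons by (simp add: xs pre_digraph.cas.simps)
  next
    case 3
    then show ?case using cons by (simp add: xs pre_digraph.awalk_verts.simps)
  }
qed

lemma hamiltonian_of_vertex_list:
  fixes G :: "'a pair_pre_digraph"
  assumes "distinct vs" "3 \<le> length vs" "set vs = pverts G"
    and succ: "successively (\<lambda>x y. (x, y) \<in> parcs G) vs" and closed: "(last vs, hd vs) \<in> parcs G"
  shows "hamiltonian (with_proj G)"
proof -
  \<comment> \<open>An arc of a pair digraph is the pair of its ends, so pairing each vertex with
    its cyclic successor gives the arc list of the closed walk.\<close>
  define p where "p = zip vs (tl vs @ [hd vs])"
  have ne: "vs \<noteq> []" and len: "length p = length vs"
    using assms(2) by (auto simp: p_def)
  have "successively (\<lambda>x y. (x, y) \<in> parcs G) (vs @ [hd vs])"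
    using succ closed ne by (simp add: successively_append_iff)
  note walk = awalk_of_vertex_list[OF ne this, folded p_def]
  \<comment> \<open>A cycle requires the vertices of its walk to be distinct after the first is
    dropped; here that leaves a rotation of \<open>vs\<close>.\<close>
  have "distinct (tl vs @ [hd vs])"
    using \<open>distinct vs\<close> ne by (cases vs) auto
  moreover have "fst ` set p = set vs"
    using ne by (simp add: p_def flip: set_map)
  ultimately have "pre_digraph.cycle (with_proj G) p"
    using walk ne assms(3) len
    by (auto simp: pre_digraph.cycle_def pre_digraph.awalk_def intro!: exI[of _ "hd vs"])
  then show ?thesis
    unfolding hamiltonian_def using \<open>fst ` set p = set vs\<close> assms(2,3) len by auto
qed

text \<open>The leading \<open>z0\<close> makes the induction work: once one element of each list is
  consumed, the element of \<open>zs\<close> just passed takes over its role.\<close>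

lemma successively_splice:
  assumes "length us = length zs"
    and "\<And>u z. u \<in> set us \<Longrightarrow> z \<in> insert z0 (set zs) \<Longrightarrow> r u z \<and> r z u"
  shows "successively r (z0 # splice us zs)"
  using assms by (induction us zs arbitrary: z0 rule: list_induct2) auto

lemma last_splice:
  assumes "length us = length zs" "zs \<noteq> []"
  shows "last (splice us zs) = last zs"
  using assms
proof (induction us zs rule: list_induct2)
  case (Cons u us z zs)
  then show ?case by (cases us; cases zs) auto
qed simp

lemma set_splice: "set (splice us zs) = set us \<union> set zs"
  by (induction us zs rule: splice.induct) auto

lemma distinct_splice:
  assumes "distinct us" "distinct zs" "set us \<inter> set zs = {}"
  shows "distinct (splice us zs)"
  using assms by (induction us zs rule: splice.induct) (auto simp: set_splice)

text \<open>With equal sizes, an alternating list starts in \<open>U\<close> and ends in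
  \<open>Z\<close>, so it closes up by an arc between the two sides. Two elements on each side give
  length at least 4.\<close>

lemma hamiltonian_alternating:
  fixes G :: "'a pair_pre_digraph"
  assumes fin: "finite U" "finite Z" and "U \<inter> Z = {}" and verts: "pverts G = U \<union> Z"
    and adj: "\<And>u z. u \<in> U \<Longrightarrow> z \<in> Z \<Longrightarrow> (u, z) \<in> parcs G \<and> (z, u) \<in> parcs G"
    and "card U = card Z" "2 \<le> card Z"
  shows "hamiltonian (with_proj G)"
proof -
  obtain us zs where us: "set us = U" "distinct us" and zs: "set zs = Z" "distinct zs"
    using fin finite_distinct_list by metis
  have len: "length us = length zs" "2 \<le> length zs"
    using us zs assms(6,7) by (simp_all flip: distinct_card)
  then have ne: "us \<noteq> []" "zs \<noteq> []" by auto
  \<comment> \<open>Any element of \<open>Z\<close> could stand in front; it is dropped again at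
    once.\<close>
  have "successively (\<lambda>x y. (x, y) \<in> parcs G) (last zs # splice us zs)"
    by (rule successively_splice) (use len us zs adj ne in auto)
  then have "successively (\<lambda>x y. (x, y) \<in> parcs G) (splice us zs)"
    by (auto simp: successively_Cons)
  moreover have "hd (splice us zs) = hd us"
    using ne by (cases us; cases zs) auto
  moreover have "distinct (splice us zs)"
    using us zs assms(3) by (simp add: distinct_splice)
  ultimately show ?thesis
    using len ne us zs adj verts
    by (intro hamiltonian_of_vertex_list[of "splice us zs"])
      (auto simp: set_splice last_splice)
qed

text \<open>With one surplus element in \<open>Z\<close>, an alternating list has both ends in
  \<open>Z\<close>; choosing them as \<open>z0\<close> and \<open>z1\<close> makes the given arc the
  closing one.\<close>

lemma hamiltonian_alternating_Suc:
  fixes G :: "'a pair_pre_digraph"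
  assumes fin: "finite U" "finite Z" and "U \<inter> Z = {}" and verts: "pverts G = U \<union> Z"
    and adj: "\<And>u z. u \<in> U \<Longrightarrow> z \<in> Z \<Longrightarrow> (u, z) \<in> parcs G \<and> (z, u) \<in> parcs G"
    and card: "card Z = Suc (card U)"
    and z: "z0 \<in> Z" "z1 \<in> Z" "z0 \<noteq> z1" "(z1, z0) \<in> parcs G"
  shows "hamiltonian (with_proj G)"
proof -
  obtain us ys where us: "set us = U" "distinct us" and ys: "set ys = Z - {z0, z1}" "distinct ys"
    using fin finite_distinct_list finite_Diff by metis
  \<comment> \<open>\<open>z1\<close> is put last because the splice of lists of equal length ends
    with the last element of the second.\<close>
  define zs where "zs = ys @ [z1]"
  have zs: "set zs = Z - {z0}" "distinct zs" "last zs = z1" "zs \<noteq> []"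
    using ys z by (auto simp: zs_def)
  have "length zs = card (Z - {z0})"
    using zs distinct_card by metis
  then have len: "length us = length zs"
    using us z fin card by (simp flip: distinct_card)
  have "successively (\<lambda>x y. (x, y) \<in> parcs G) (z0 # splice us zs)"
    by (rule successively_splice) (use len us zs adj z in auto)
  moreover have "distinct (splice us zs)"
    using us zs assms(3) by (intro distinct_splice) auto
  moreover have "splice us zs \<noteq> []"
    using zs len by (cases us; cases zs) auto
  moreover have "length zs \<ge> 1"
    using zs by (cases zs) auto
  ultimately show ?thesis
    using len us zs z verts assms(3)
    by (intro hamiltonian_of_vertex_list[of "z0 # splice us zs"])
      (auto simp: set_splice last_splice)
qed

section \<open>Quaternions over the integers modulo \<open>m\<close>\<close>

definition qsum :: "int \<times> int \<times> int \<times> int \<Rightarrow> int" where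
  "qsum = (\<lambda>(a, b, c, d). a + b + c + d)"

context residues
begin

lemma quaternion_carrier:
  "carrier (quaternion_ring R) = {0..m - 1} \<times> {0..m - 1} \<times> {0..m - 1} \<times> {0..m - 1}"
  by (simp add: quaternion_ring_def res_carrier_eq)

lemma quaternion_zero: "\<zero>\<^bsub>quaternion_ring R\<^esub> = (0, 0, 0, 0)"
  by (simp add: quaternion_ring_def res_zero_eq)

lemma quaternion_one: "\<one>\<^bsub>quaternion_ring R\<^esub> = (1, 0, 0, 0)"
  by (simp add: quaternion_ring_def res_zero_eq res_one_eq)

lemma quaternion_minus_one: "\<ominus>\<^bsub>quaternion_ring R\<^esub> \<one>\<^bsub>quaternion_ring R\<^esub> = (m - 1, 0, 0, 0)"
proof -
  interpret Q: ring "quaternion_ring R"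
    by (rule quaternion_ring_is_ring)
  show ?thesis
    by (rule Q.minus_equality)
      (use m_gt_one in \<open>auto simp: quaternion_carrier quaternion_one quaternion_zero,
        auto simp: quaternion_ring_def res_add_eq\<close>)
qed

lemma quaternion_mult:
  "(a1, a2, a3, a4) \<otimes>\<^bsub>quaternion_ring R\<^esub> (b1, b2, b3, b4) =
    ((a1 * b1 - a2 * b2 - a3 * b3 - a4 * b4) mod m,
     (a1 * b2 + a2 * b1 + a3 * b4 - a4 * b3) mod m,
     (a1 * b3 - a2 * b4 + a3 * b1 + a4 * b2) mod m,
     (a1 * b4 + a2 * b3 - a3 * b2 + a4 * b1) mod m)"
  by (simp add: quaternion_ring_def a_minus_def res_add_eq res_mult_eq res_neg_eq mod_simps)

text \<open>The conjugate times a quaternion is its norm, so a left factor whose norm is invertible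
  modulo \<open>m\<close> can be cancelled.\<close>

lemma quaternion_mult_nonzero:
  assumes "coprime (a1\<^sup>2 + a2\<^sup>2 + a3\<^sup>2 + a4\<^sup>2) m"
    and "y \<in> carrier (quaternion_ring R)" "y \<noteq> \<zero>\<^bsub>quaternion_ring R\<^esub>"
  shows "(a1, a2, a3, a4) \<otimes>\<^bsub>quaternion_ring R\<^esub> y \<noteq> \<zero>\<^bsub>quaternion_ring R\<^esub>"
proof
  obtain b1 b2 b3 b4 where y: "y = (b1, b2, b3, b4)"
    by (cases y)
  let ?N = "a1\<^sup>2 + a2\<^sup>2 + a3\<^sup>2 + a4\<^sup>2"
  \<comment> \<open>The coordinates of the product before reduction, so that the conjugate
    identities can be checked over the integers.\<close>
  define p1 where "p1 = a1 * b1 - a2 * b2 - a3 * b3 - a4 * b4"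
  define p2 where "p2 = a1 * b2 + a2 * b1 + a3 * b4 - a4 * b3"
  define p3 where "p3 = a1 * b3 - a2 * b4 + a3 * b1 + a4 * b2"
  define p4 where "p4 = a1 * b4 + a2 * b3 - a3 * b2 + a4 * b1"
  note p_defs = p1_def p2_def p3_def p4_def
  assume "(a1, a2, a3, a4) \<otimes>\<^bsub>quaternion_ring R\<^esub> y = \<zero>\<^bsub>quaternion_ring R\<^esub>"
  then have dvd: "m dvd p1" "m dvd p2" "m dvd p3" "m dvd p4"
    by (auto simp: y quaternion_mult quaternion_zero p_defs)
  \<comment> \<open>Left multiplication by the conjugate of \<open>(a1, a2, a3, a4)\<close>.\<close>
  have "?N * b1 = a1 * p1 + a2 * p2 + a3 * p3 + a4 * p4"
    "?N * b2 = a1 * p2 - a2 * p1 - a3 * p4 + a4 * p3"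
    "?N * b3 = a1 * p3 + a2 * p4 - a3 * p1 - a4 * p2"
    "?N * b4 = a1 * p4 - a2 * p3 + a3 * p2 - a4 * p1"
    by (simp_all add: p_defs power2_eq_square algebra_simps)
  then have "m dvd ?N * b1" "m dvd ?N * b2" "m dvd ?N * b3" "m dvd ?N * b4"
    using dvd by (simp_all add: dvd_add dvd_diff)
  then have "m dvd b1" "m dvd b2" "m dvd b3" "m dvd b4"
    using assms(1) by (simp_all add: coprime_commute coprime_dvd_mult_right_iff)
  then have "b1 = 0" "b2 = 0" "b3 = 0" "b4 = 0"
    using assms(2) by (auto simp: y quaternion_carrier dest: zdvd_imp_le)
  then show False
    using assms(3) by (simp add: y quaternion_zero)
qed

lemma card_odd_quaternions_eq_card_even:
  assumes "even m"
  shows "card {x \<in> carrier (quaternion_ring R). odd (qsum x)} =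
    card {x \<in> carrier (quaternion_ring R). even (qsum x)}"
proof -
  \<comment> \<open>\<open>f\<close> swaps \<open>2 * t\<close> and \<open>2 * t + 1\<close> in the
    first coordinate. It is its own inverse, and it preserves the range \<open>0..m - 1\<close>
    because \<open>m\<close> is even.\<close>
  define f :: "int \<times> int \<times> int \<times> int \<Rightarrow> int \<times> int \<times> int \<times> int"
    where "f = (\<lambda>(a, b, c, d). (if even a then a + 1 else a - 1, b, c, d))"
  have ne: "a + 1 < m" if "even a" "a < m" for a
    using that assms by presburger
  have pos: "0 < a" if "odd a" "0 \<le> a" for a :: int
    using that by presburger
  show ?thesis
    by (rule bij_betw_same_card[of f], rule bij_betw_byWitness[of _ f])
      (auto simp: f_def qsum_def quaternion_carrier ne pos)
qed

end

section \<open>Adjacency and counting for \<open>m = 2 ^ n\<close>\<close>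

theorem theorem4p6:
  fixes n :: nat
  assumes "n > 0"
  shows "hamiltonian (with_proj (non_zero_divisor_graph (quaternion_ring (residue_ring (2 ^ n)))))"
proof -
  define m :: int where "m = 2 ^ n"
  define Q where "Q = quaternion_ring (residue_ring m)"
  have "even m" "m \<ge> 2"
    using assms by (simp_all add: m_def self_le_power)
  interpret residues m "residue_ring m"
    by unfold_locales (use \<open>m \<ge> 2\<close> in auto)
  \<comment> \<open>As \<open>m\<close> is even, both 1 and -1 have odd coordinate sum, while 0 has
    even sum; this decides which class loses which excluded element.\<close>
  define U where "U = {x \<in> carrier Q. odd (qsum x)} - {(1, 0, 0, 0), (m - 1, 0, 0, 0)}"
  define Z where "Z = {x \<in> carrier Q. even (qsum x)} - {(0, 0, 0, 0)}"
  let ?G = "non_zero_divisor_graph Q"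
  note carrier = quaternion_carrier[folded Q_def]
  note ids = quaternion_zero[folded Q_def] quaternion_one[folded Q_def]
    quaternion_minus_one[unfolded quaternion_one, folded Q_def]
  have fin: "finite (carrier Q)"
    by (simp add: carrier)
  have finUZ: "finite U" "finite Z" and disj: "U \<inter> Z = {}"
    using fin by (auto simp: U_def Z_def)
  have verts: "pverts ?G = U \<union> Z"
    using \<open>even m\<close> by (auto simp: non_zero_divisor_graph_def ids U_def Z_def qsum_def)
  have arcs: "(x, y) \<in> parcs ?G \<longleftrightarrow> x \<in> U \<union> Z \<and> y \<in> U \<union> Z \<and> x \<noteq> y \<and>
      (x \<otimes>\<^bsub>Q\<^esub> y \<noteq> \<zero>\<^bsub>Q\<^esub> \<or> y \<otimes>\<^bsub>Q\<^esub> x \<noteq> \<zero>\<^bsub>Q\<^esub>)" for x y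
    unfolding verts[symmetric] by (auto simp: non_zero_divisor_graph_def Let_def)
  have adj: "(u, z) \<in> parcs ?G \<and> (z, u) \<in> parcs ?G" if "u \<in> U" "z \<in> Z" for u z
  proof -
    obtain a1 a2 a3 a4 where u: "u = (a1, a2, a3, a4)"
      by (cases u)
    \<comment> \<open>Squaring preserves parity, so the norm has the parity of
      \<open>qsum u\<close>.\<close>
    have "odd (a1\<^sup>2 + a2\<^sup>2 + a3\<^sup>2 + a4\<^sup>2)"
      using that(1) by (auto simp: u U_def qsum_def)
    then have "coprime (a1\<^sup>2 + a2\<^sup>2 + a3\<^sup>2 + a4\<^sup>2) m"
      by (simp add: m_def coprime_right_2_iff_odd)
    then have "u \<otimes>\<^bsub>Q\<^esub> z \<noteq> \<zero>\<^bsub>Q\<^esub>"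
      unfolding u Q_def
      by (rule quaternion_mult_nonzero) (use that(2) in \<open>auto simp: Z_def Q_def quaternion_zero\<close>)
    then show ?thesis
      using that disj by (auto simp: arcs)
  qed
  \<comment> \<open>\<open>z0\<close> is 1 + j and \<open>z1\<close> is 1 + i. The product
    \<open>z1\<close> times \<open>z0\<close> is 1 + i + j + k, nonzero for every
    \<open>m \<ge> 2\<close>.\<close>
  define z0 z1 :: "int \<times> int \<times> int \<times> int" where "z0 = (1, 0, 1, 0)" and "z1 = (1, 1, 0, 0)"
  have z: "z0 \<in> Z" "z1 \<in> Z" "z0 \<noteq> z1"
    using \<open>m \<ge> 2\<close> by (auto simp: z0_def z1_def Z_def qsum_def carrier)
  have "z1 \<otimes>\<^bsub>Q\<^esub> z0 \<noteq> \<zero>\<^bsub>Q\<^esub>"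
    using \<open>m \<ge> 2\<close> by (simp add: z0_def z1_def Q_def quaternion_mult quaternion_zero)
  then have z_adj: "(z1, z0) \<in> parcs ?G"
    using z by (auto simp: arcs)
  define h where "h = card {x \<in> carrier Q. even (qsum x)}"
  have "card Z = h - 1"
    unfolding Z_def h_def by (subst card_Diff_subset) (use \<open>m \<ge> 2\<close> in \<open>auto simp: qsum_def carrier\<close>)
  \<comment> \<open>Besides bounding the cycle length, this gives \<open>h \<ge> 3\<close>, so the
    truncated subtractions \<open>h - 1\<close> and \<open>h - 2\<close> are exact.\<close>
  have "card {z0, z1} \<le> card Z"
    using z finUZ by (intro card_mono) auto
  then have "card Z \<ge> 2"
    using z by simp
  have "card U = h - card {(1, 0, 0, 0), (m - 1, 0 :: int, 0 :: int, 0 :: int)}"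
    unfolding h_def card_odd_quaternions_eq_card_even[OF \<open>even m\<close>, folded Q_def, symmetric] U_def
    by (rule card_Diff_subset) (use \<open>m \<ge> 2\<close> \<open>even m\<close> in \<open>auto simp: qsum_def carrier\<close>)
  \<comment> \<open>For \<open>m = 2\<close> the elements 1 and -1 coincide, so \<open>U\<close>
    loses only one element.\<close>
  then have cardU: "card U = (if m = 2 then h - 1 else h - 2)"
    by auto
  have "hamiltonian (with_proj ?G)"
  proof (cases "m = 2")
    case True
    then show ?thesis
      using hamiltonian_alternating[OF finUZ disj verts adj] cardU \<open>card Z = h - 1\<close> \<open>card Z \<ge> 2\<close>
      by simp
  next
    case False
    then have "card Z = Suc (card U)"
      using cardU \<open>card Z = h - 1\<close> \<open>card Z \<ge> 2\<close> by simp
    then show ?thesis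
      using hamiltonian_alternating_Suc[OF finUZ disj verts adj _ z z_adj] by simp
  qed
  then show ?thesis
    by (simp add: Q_def m_def)
qed

end
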